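(* For every integer $n\geq 4$, the class $\mathcal{K}_n$ is closed under direct sum: if $M,M'\in\mathcal{K}_n$ have disjoint ground sets, then $M\oplus M'\in\mathcal{K}_n$.
   Context: All matroids are finite. For a matroid $M$ with rank function $r$ and ground set $E(M)$, and an integer $n\geq 4$, the $n$-th Kinser inequality for a family $X_1,\dots,X_n$ of subsets of $E(M)$ is $$\sum_{i=3}^n r(X_i)+r(X_1\cup X_2)+r(X_1\cup X_3\cup X_n)+\sum_{i=4}^n r(X_2\cup X_{i-1}\cup X_i)\leq r(X_1\cup X_3)+r(X_1\cup X_n)+\sum_{i=3}^n r(X_2\cup X_i)+\sum_{i=4}^n r(X_{i-1}\cup X_i).$$ $\mathcal{K}_n$ is the class of matroids $M$ that satisfy the $n$-th Kinser inequality for all families $X_1,\dots,X_n$ of subsets of $E(M)$. For matroids $M=(E,r)$ and $M'=(E',r')$ with $E\cap E'=\varnothing$, the direct sum $M\oplus M'$ has ground set $E\cup E'$, and the rank of $X\subseteq E\cup E'$ is $r(X\cap E)+r'(X\cap E')$. *)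

theory Defs
  imports Main
begin

text \<open>
  A finite matroid is given by its ground set and its rank function. The rank function is a
  total function on sets; only its values on subsets of the ground set matter.
\<close>

record 'a matroid_data =
  ground :: "'a set"
  rank :: "'a set \<Rightarrow> nat"

definition matroid :: "'a matroid_data \<Rightarrow> bool" where
  "matroid M \<longleftrightarrow>
     finite (ground M) \<and>
     (\<forall>X. X \<subseteq> ground M \<longrightarrow> rank M X \<le> card X) \<and>
     (\<forall>X Y. X \<subseteq> Y \<and> Y \<subseteq> ground M \<longrightarrow> rank M X \<le> rank M Y) \<and>
     (\<forall>X Y. X \<subseteq> ground M \<and> Y \<subseteq> ground M \<longrightarrow>
        rank M (X \<union> Y) + rank M (X \<inter> Y) \<le> rank M X + rank M Y)"

text \<open>Only used for \<open>n \<ge> 4\<close>; a family \<open>X\<^sub>1, \<dots>, X\<^sub>n\<close> is given by the values of \<open>X\<close> on \<open>{1..n}\<close>.\<close>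

definition Kinser_inequality :: "nat \<Rightarrow> 'a matroid_data \<Rightarrow> (nat \<Rightarrow> 'a set) \<Rightarrow> bool" where
  "Kinser_inequality n M X \<longleftrightarrow>
     (\<Sum>i=3..n. rank M (X i)) + rank M (X 1 \<union> X 2) + rank M (X 1 \<union> X 3 \<union> X n)
       + (\<Sum>i=4..n. rank M (X 2 \<union> X (i - 1) \<union> X i))
     \<le> rank M (X 1 \<union> X 3) + rank M (X 1 \<union> X n) + (\<Sum>i=3..n. rank M (X 2 \<union> X i))
       + (\<Sum>i=4..n. rank M (X (i - 1) \<union> X i))"

definition Kinser_class :: "nat \<Rightarrow> 'a matroid_data set" where
  "Kinser_class n =
     {M. matroid M \<and> (\<forall>X. (\<forall>i\<in>{1..n}. X i \<subseteq> ground M) \<longrightarrow> Kinser_inequality n M X)}"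

text \<open>Meaningful for matroids with disjoint ground sets.\<close>

definition direct_sum :: "'a matroid_data \<Rightarrow> 'a matroid_data \<Rightarrow> 'a matroid_data" where
  "direct_sum M M' =
     \<lparr>ground = ground M \<union> ground M',
      rank = (\<lambda>X. rank M (X \<inter> ground M) + rank M' (X \<inter> ground M'))\<rparr>"

end

theory Submission
  imports Defs
begin

text \<open>
  Both the rank axioms and the Kinser inequality are linear in the rank function, and every set
  that occurs in them is built from the given sets by unions and intersections. Intersecting with
  a fixed set commutes with these operations. Hence each inequality for the direct sum, at the
  given sets, is the sum of the same inequality for \<open>M\<close> and for \<open>M'\<close>, at the traces of
  those sets on the two ground sets. For the bound of the rank by the cardinality this uses that
  the ground sets are disjoint: then the cardinality of a set is the sum of those of its traces.
\<close>

lemma matroid_direct_sum: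
  assumes M: "matroid M" and M': "matroid M'" and disj: "ground M \<inter> ground M' = {}"
  shows "matroid (direct_sum M M')"
  unfolding matroid_def
proof (intro conjI allI impI)
  show "finite (ground (direct_sum M M'))"
    using M M' by (simp add: matroid_def direct_sum_def)
next
  fix X assume X: "X \<subseteq> ground (direct_sum M M')"
  let ?A = "X \<inter> ground M" and ?B = "X \<inter> ground M'"
  have fin: "finite ?A" "finite ?B"
    using M M' by (auto simp: matroid_def)
  have "rank M ?A \<le> card ?A" "rank M' ?B \<le> card ?B"
    using M M' by (auto simp: matroid_def)
  moreover have "card ?A + card ?B = card (?A \<union> ?B)"
    using fin disj by (intro card_Un_disjoint[symmetric]) auto
  moreover have "?A \<union> ?B = X"
    using X by (auto simp: direct_sum_def)
  ultimately show "rank (direct_sum M M') X \<le> card X"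
    by (simp add: direct_sum_def)
next
  fix X Y assume "X \<subseteq> Y \<and> Y \<subseteq> ground (direct_sum M M')"
  then have "rank M (X \<inter> ground M) \<le> rank M (Y \<inter> ground M)"
    and "rank M' (X \<inter> ground M') \<le> rank M' (Y \<inter> ground M')"
    using M M' unfolding matroid_def by (meson Int_lower2 Int_mono subset_refl)+
  then show "rank (direct_sum M M') X \<le> rank (direct_sum M M') Y"
    by (simp add: direct_sum_def)
next
  fix X Y
  have submodular: "rank N ((X \<union> Y) \<inter> ground N) + rank N ((X \<inter> Y) \<inter> ground N)
      \<le> rank N (X \<inter> ground N) + rank N (Y \<inter> ground N)"
    if N: "matroid N" for N :: "'a matroid_data"
  proof -
    have "rank N ((X \<inter> ground N) \<union> (Y \<inter> ground N)) + rank N ((X \<inter> ground N) \<inter> (Y \<inter> ground N))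
        \<le> rank N (X \<inter> ground N) + rank N (Y \<inter> ground N)"
      using N by (simp add: matroid_def)
    moreover have "(X \<inter> ground N) \<inter> (Y \<inter> ground N) = (X \<inter> Y) \<inter> ground N"
      by blast
    ultimately show ?thesis
      by (simp add: Int_Un_distrib2)
  qed
  show "rank (direct_sum M M') (X \<union> Y) + rank (direct_sum M M') (X \<inter> Y)
      \<le> rank (direct_sum M M') X + rank (direct_sum M M') Y"
    using submodular[OF M] submodular[OF M'] by (simp add: direct_sum_def)
qed

lemma Kinser_inequality_direct_sum:
  assumes "Kinser_inequality n M (\<lambda>i. X i \<inter> ground M)"
    and "Kinser_inequality n M' (\<lambda>i. X i \<inter> ground M')"
  shows "Kinser_inequality n (direct_sum M M') X"
  using assms unfolding Kinser_inequality_def direct_sum_def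
  by (simp add: Int_Un_distrib2 sum.distrib)

theorem lemma3p13:
  fixes n :: nat and M M' :: "'a matroid_data"
  assumes "n \<ge> 4"
    and "M \<in> Kinser_class n"
    and "M' \<in> Kinser_class n"
    and "ground M \<inter> ground M' = {}"
  shows "direct_sum M M' \<in> Kinser_class n"
proof -
  have trace: "Kinser_inequality n N (\<lambda>i. X i \<inter> ground N)"
    if "N \<in> Kinser_class n" for N :: "'a matroid_data" and X
    using that by (simp add: Kinser_class_def)
  have "Kinser_inequality n (direct_sum M M') X" for X
    using assms(2,3) by (intro Kinser_inequality_direct_sum trace)
  moreover have "matroid (direct_sum M M')"
    using assms by (intro matroid_direct_sum) (auto simp: Kinser_class_def)
  ultimately show ?thesis
    by (simp add: Kinser_class_def)
qed

end
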